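(* There exists an algorithm that, given a binary cotree $T$ of a cograph $G$ with $n$ vertices, produces an optimal acyclic coloring of $G$ in $O(n)$ time. Moreover, the obtained coloring is also an optimal star coloring of $G$.
   Context: Cographs: a single vertex is a cograph; disjoint unions and joins (disjoint union plus all edges between distinct parts) of cographs are cographs. A cotree of a cograph $G$ is a rooted tree whose leaves correspond bijectively to the vertices of $G$ and whose internal nodes are labeled $\oplus$ or $\cup$, such that two distinct vertices are adjacent iff the lowest common ancestor of their leaves is a $\oplus$-node; it is binary if every internal node has exactly two children. An acyclic coloring is a proper vertex coloring in which the union of any two color classes induces a forest; a star coloring is a proper vertex coloring in which the union of any two color classes induces a disjoint union of stars. Optimal means using the minimum possible number of colors ($\chi_a(G)$, resp. $\chi_s(G)$). *)

theory Defs
  imports Complex_Main "HOL-Library.Landau_Symbols" "HOL-Library.Disjoint_Sets"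
begin

section \<open>Graphs and cographs\<close>

record 'a graph =
  verts :: "'a set"
  edges :: "'a set set"

definition graph_union :: "'a graph \<Rightarrow> 'a graph \<Rightarrow> 'a graph" where
  "graph_union G H = \<lparr>verts = verts G \<union> verts H, edges = edges G \<union> edges H\<rparr>"

definition graph_join :: "'a graph \<Rightarrow> 'a graph \<Rightarrow> 'a graph" where
  "graph_join G H = \<lparr>verts = verts G \<union> verts H,
     edges = edges G \<union> edges H \<union> {{u, v} |u v. u \<in> verts G \<and> v \<in> verts H}\<rparr>"

inductive cograph :: "'a graph \<Rightarrow> bool" where
  single: "cograph \<lparr>verts = {v}, edges = {}\<rparr>"
| union: "\<lbrakk>cograph G; cograph H; verts G \<inter> verts H = {}\<rbrakk> \<Longrightarrow> cograph (graph_union G H)"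
| join: "\<lbrakk>cograph G; cograph H; verts G \<inter> verts H = {}\<rbrakk> \<Longrightarrow> cograph (graph_join G H)"

definition induced :: "'a graph \<Rightarrow> 'a set \<Rightarrow> 'a graph" where
  "induced G S = \<lparr>verts = verts G \<inter> S, edges = {e \<in> edges G. e \<subseteq> S}\<rparr>"

definition is_cycle :: "'a graph \<Rightarrow> 'a list \<Rightarrow> bool" where
  "is_cycle G xs \<longleftrightarrow> length xs \<ge> 3 \<and> distinct xs \<and> set xs \<subseteq> verts G \<and>
     (\<forall>i<length xs. {xs ! i, xs ! (Suc i mod length xs)} \<in> edges G)"

definition forest :: "'a graph \<Rightarrow> bool" where
  "forest G \<longleftrightarrow> (\<nexists>xs. is_cycle G xs)"

text \<open>A star is \<open>K\<^bsub>1,k\<^esub>\<close> with \<open>k \<ge> 0\<close>; in particular a single vertex is a star.\<close>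

definition star :: "'a graph \<Rightarrow> bool" where
  "star G \<longleftrightarrow> (\<exists>c \<in> verts G. edges G = {{c, x} |x. x \<in> verts G - {c}})"

definition disjoint_union_of_stars :: "'a graph \<Rightarrow> bool" where
  "disjoint_union_of_stars G \<longleftrightarrow>
     (\<exists>P. partition_on (verts G) P \<and> (\<forall>A\<in>P. star (induced G A)) \<and>
          edges G = (\<Union>A\<in>P. edges (induced G A)))"


section \<open>Acyclic and star colorings\<close>

definition proper_coloring :: "'a graph \<Rightarrow> ('a \<Rightarrow> nat) \<Rightarrow> bool" where
  "proper_coloring G f \<longleftrightarrow> (\<forall>u v. {u, v} \<in> edges G \<longrightarrow> f u \<noteq> f v)"

definition color_class :: "'a graph \<Rightarrow> ('a \<Rightarrow> nat) \<Rightarrow> nat \<Rightarrow> 'a set" where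
  "color_class G f i = {v \<in> verts G. f v = i}"

definition acyclic_coloring :: "'a graph \<Rightarrow> ('a \<Rightarrow> nat) \<Rightarrow> bool" where
  "acyclic_coloring G f \<longleftrightarrow> proper_coloring G f \<and>
     (\<forall>i \<in> f ` verts G. \<forall>j \<in> f ` verts G. i \<noteq> j \<longrightarrow>
        forest (induced G (color_class G f i \<union> color_class G f j)))"

definition star_coloring :: "'a graph \<Rightarrow> ('a \<Rightarrow> nat) \<Rightarrow> bool" where
  "star_coloring G f \<longleftrightarrow> proper_coloring G f \<and>
     (\<forall>i \<in> f ` verts G. \<forall>j \<in> f ` verts G. i \<noteq> j \<longrightarrow>
        disjoint_union_of_stars (induced G (color_class G f i \<union> color_class G f j)))"

definition num_colors :: "'a graph \<Rightarrow> ('a \<Rightarrow> nat) \<Rightarrow> nat" where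
  "num_colors G f = card (f ` verts G)"

definition acyclic_chromatic_number :: "'a graph \<Rightarrow> nat" where
  "acyclic_chromatic_number G = (LEAST k. \<exists>f. acyclic_coloring G f \<and> num_colors G f = k)"

definition star_chromatic_number :: "'a graph \<Rightarrow> nat" where
  "star_chromatic_number G = (LEAST k. \<exists>f. star_coloring G f \<and> num_colors G f = k)"

definition optimal_acyclic_coloring :: "'a graph \<Rightarrow> ('a \<Rightarrow> nat) \<Rightarrow> bool" where
  "optimal_acyclic_coloring G f \<longleftrightarrow>
     acyclic_coloring G f \<and> num_colors G f = acyclic_chromatic_number G"

definition optimal_star_coloring :: "'a graph \<Rightarrow> ('a \<Rightarrow> nat) \<Rightarrow> bool" where
  "optimal_star_coloring G f \<longleftrightarrow>
     star_coloring G f \<and> num_colors G f = star_chromatic_number G"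


section \<open>Cotrees\<close>

datatype label = Cup | Oplus

datatype 'a cotree = Leaf 'a | Node label "'a cotree list"

primrec leaves :: "'a cotree \<Rightarrow> 'a list" where
  "leaves (Leaf v) = [v]"
| "leaves (Node l ts) = concat (map leaves ts)"

primrec subtrees :: "'a cotree \<Rightarrow> 'a cotree set" where
  "subtrees (Leaf v) = {Leaf v}"
| "subtrees (Node l ts) = insert (Node l ts) (\<Union> (set (map subtrees ts)))"

text \<open>When the leaves are pairwise distinct and every internal node has a child, the nodes of a
  tree correspond to its subtrees, and the ancestors of a leaf to the subtrees containing it.\<close>

definition is_lca :: "'a cotree \<Rightarrow> 'a \<Rightarrow> 'a \<Rightarrow> 'a cotree \<Rightarrow> bool" where
  "is_lca T u v s \<longleftrightarrow> s \<in> subtrees T \<and> u \<in> set (leaves s) \<and> v \<in> set (leaves s) \<and>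
     (\<forall>s' \<in> subtrees s. u \<in> set (leaves s') \<and> v \<in> set (leaves s') \<longrightarrow> s' = s)"

definition is_cotree :: "'a cotree \<Rightarrow> 'a graph \<Rightarrow> bool" where
  "is_cotree T G \<longleftrightarrow>
     (\<forall>l ts. Node l ts \<in> subtrees T \<longrightarrow> ts \<noteq> []) \<and>
     distinct (leaves T) \<and> set (leaves T) = verts G \<and>
     (\<forall>u \<in> verts G. \<forall>v \<in> verts G. u \<noteq> v \<longrightarrow>
        ({u, v} \<in> edges G \<longleftrightarrow> (\<exists>ts. is_lca T u v (Node Oplus ts))))"

definition binary :: "'a cotree \<Rightarrow> bool" where
  "binary T \<longleftrightarrow> (\<forall>l ts. Node l ts \<in> subtrees T \<longrightarrow> length ts = 2)"


section \<open>A word RAM\<close>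

text \<open>
  Programs are structured programs for a unit-cost random access machine with \<open>w\<close>-bit words.
  The memory consists of registers and zero-initialized arrays of words. Both are named by
  constants in the program text, so a program uses only finitely many of them. Arithmetic is
  addition modulo \<open>2 ^ w\<close> and truncated subtraction. Every literal, register read, array access,
  arithmetic operation, comparison, connective and command costs one time unit.
\<close>

datatype aexp =
    Const nat
  | Reg nat
  | Get nat aexp
  | Add aexp aexp
  | Sub aexp aexp

datatype bexp =
    Less aexp aexp
  | Equal aexp aexp
  | Not bexp
  | And bexp bexp

datatype com =
    Skip
  | Assign nat aexp
  | Put nat aexp aexp
  | Seq com com
  | If bexp com com
  | While bexp com

record state =
  regs :: "nat \<Rightarrow> nat"
  arrs :: "nat \<Rightarrow> nat \<Rightarrow> nat"

primrec aval :: "nat \<Rightarrow> aexp \<Rightarrow> state \<Rightarrow> nat" where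
  "aval w (Const k) s = k mod 2 ^ w"
| "aval w (Reg r) s = regs s r"
| "aval w (Get a e) s = arrs s a (aval w e s)"
| "aval w (Add d e) s = (aval w d s + aval w e s) mod 2 ^ w"
| "aval w (Sub d e) s = aval w d s - aval w e s"

primrec acost :: "aexp \<Rightarrow> nat" where
  "acost (Const k) = 1"
| "acost (Reg r) = 1"
| "acost (Get a e) = acost e + 1"
| "acost (Add d e) = acost d + acost e + 1"
| "acost (Sub d e) = acost d + acost e + 1"

primrec bval :: "nat \<Rightarrow> bexp \<Rightarrow> state \<Rightarrow> bool" where
  "bval w (Less d e) s \<longleftrightarrow> aval w d s < aval w e s"
| "bval w (Equal d e) s \<longleftrightarrow> aval w d s = aval w e s"
| "bval w (Not b) s \<longleftrightarrow> \<not> bval w b s"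
| "bval w (And b c) s \<longleftrightarrow> bval w b s \<and> bval w c s"

primrec bcost :: "bexp \<Rightarrow> nat" where
  "bcost (Less d e) = acost d + acost e + 1"
| "bcost (Equal d e) = acost d + acost e + 1"
| "bcost (Not b) = bcost b + 1"
| "bcost (And b c) = bcost b + bcost c + 1"

definition set_reg :: "nat \<Rightarrow> nat \<Rightarrow> state \<Rightarrow> state" where
  "set_reg r x s = s\<lparr>regs := (regs s)(r := x)\<rparr>"

definition set_arr :: "nat \<Rightarrow> nat \<Rightarrow> nat \<Rightarrow> state \<Rightarrow> state" where
  "set_arr a i x s = s\<lparr>arrs := (arrs s)(a := (arrs s a)(i := x))\<rparr>"

text \<open>\<open>exec w P s t s'\<close>: with word size \<open>w\<close>, program \<open>P\<close> started in \<open>s\<close> halts in \<open>s'\<close> after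
  exactly \<open>t\<close> time units.\<close>

inductive exec :: "nat \<Rightarrow> com \<Rightarrow> state \<Rightarrow> nat \<Rightarrow> state \<Rightarrow> bool" for w :: nat where
  Skip: "exec w Skip s 1 s"
| Assign: "exec w (Assign r e) s (acost e + 1) (set_reg r (aval w e s) s)"
| Put: "exec w (Put a d e) s (acost d + acost e + 1) (set_arr a (aval w d s) (aval w e s) s)"
| Seq: "\<lbrakk>exec w P s t s'; exec w Q s' t' s''\<rbrakk> \<Longrightarrow> exec w (Seq P Q) s (t + t' + 1) s''"
| IfTrue: "\<lbrakk>bval w b s; exec w P s t s'\<rbrakk> \<Longrightarrow> exec w (If b P Q) s (bcost b + t + 1) s'"
| IfFalse: "\<lbrakk>\<not> bval w b s; exec w Q s t s'\<rbrakk> \<Longrightarrow> exec w (If b P Q) s (bcost b + t + 1) s'"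
| WhileFalse: "\<not> bval w b s \<Longrightarrow> exec w (While b P) s (bcost b + 1) s"
| WhileTrue: "\<lbrakk>bval w b s; exec w P s t s'; exec w (While b P) s' t' s''\<rbrakk>
    \<Longrightarrow> exec w (While b P) s (bcost b + t + t' + 1) s''"

inductive_cases exec_SkipE: "exec w Skip s t s'"
inductive_cases exec_AssignE: "exec w (Assign r e) s t s'"
inductive_cases exec_PutE: "exec w (Put a d e) s t s'"
inductive_cases exec_SeqE: "exec w (Seq P Q) s t s'"
inductive_cases exec_IfE: "exec w (If b P Q) s t s'"
inductive_cases exec_WhileE: "exec w (While b P) s t s'"

lemma exec_deterministic:
  "exec w P s t s' \<Longrightarrow> exec w P s t' s'' \<Longrightarrow> t' = t \<and> s'' = s'"
proof (induction arbitrary: t' s'' rule: exec.induct)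
  case (Skip s)
  then show ?case by (rule exec_SkipE) simp
next
  case (Assign r e s)
  then show ?case by (rule exec_AssignE) simp
next
  case (Put a d e s)
  then show ?case by (rule exec_PutE) simp
next
  case (Seq P s t1 s1 Q t2 s2)
  from Seq.prems show ?case by (rule exec_SeqE) (metis Seq.IH Suc_eq_plus1)
next
  case (IfTrue b s P t1 s1 Q)
  from IfTrue.prems show ?case by (rule exec_IfE) (metis IfTrue.IH Suc_eq_plus1, metis IfTrue.hyps(1))
next
  case (IfFalse b s Q t1 s1 P)
  from IfFalse.prems show ?case by (rule exec_IfE) (metis IfFalse.hyps(1), metis IfFalse.IH Suc_eq_plus1)
next
  case (WhileFalse b s P)
  from WhileFalse.prems show ?case by (rule exec_WhileE) (simp, metis WhileFalse.hyps(1))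
next
  case (WhileTrue b s P t1 s1 t2 s2)
  from WhileTrue.prems show ?case by (rule exec_WhileE) (metis WhileTrue.hyps(1), metis WhileTrue.IH Suc_eq_plus1)
qed


section \<open>Input and output\<close>

text \<open>A cotree is given in prefix (Polish) notation: one word per node, \<open>0\<close> for a \<open>\<union>\<close>-node,
  \<open>1\<close> for a \<open>\<oplus>\<close>-node, and \<open>v + 2\<close> for the leaf of vertex \<open>v\<close>. For binary cotrees this
  determines the tree.\<close>

primrec label_code :: "label \<Rightarrow> nat" where
  "label_code Cup = 0"
| "label_code Oplus = 1"

primrec encode :: "nat cotree \<Rightarrow> nat list" where
  "encode (Leaf v) = [v + 2]"
| "encode (Node l ts) = label_code l # concat (map encode ts)"

text \<open>Initially array \<open>0\<close> holds the input and register \<open>0\<close> its length.\<close>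

definition input_state :: "nat list \<Rightarrow> state" where
  "input_state xs =
     \<lparr>regs = (\<lambda>r. if r = 0 then length xs else 0),
      arrs = (\<lambda>a i. if a = 0 \<and> i < length xs then xs ! i else 0)\<rparr>"

text \<open>On halting, the color of vertex \<open>v\<close> is entry \<open>v\<close> of array \<open>1\<close>.\<close>

definition output_coloring :: "state \<Rightarrow> nat \<Rightarrow> nat" where
  "output_coloring s v = arrs s 1 v"

end

theory Submission imports Defs begin

text \<open>
  In a join, an acyclic coloring is injective on one of the two sides, since two repeated colors on
  opposite sides give a bichromatic 4-cycle; and the two sides share no color. Hence the acyclic
  chromatic number obeys \<open>chi (a \<union> b) = max (chi a) (chi b)\<close> and
  \<open>chi (a \<oplus> b) = min (chi a + |b|) (chi b + |a|)\<close>. Choosing the better side at each join and coloring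
  the other side injectively attains this number, and such a coloring has no bichromatic path on four
  vertices, so it is even a star coloring. As star colorings have no bichromatic 4-cycle either, the
  same lower bound applies to them.

  In prefix notation a subtree with \<open>m\<close> leaves occupies \<open>2 m - 1\<close> cells, so child positions can be
  computed from the numbers of leaves. One sweep from right to left tabulates the numbers of leaves
  and the values of \<open>chi\<close>; a second one from left to right hands out intervals of colors, keeping the
  intervals of the pending subtrees on a stack.
\<close>

section \<open>Binary cotrees\<close>

text \<open>A fixed pair of children allows structural recursion without lists; the generated set
  function serves as the vertex set.\<close>

datatype (bverts: 'a) bcotree = BLeaf 'a | BNode label "'a bcotree" "'a bcotree"

primrec cotree_of :: "'a bcotree \<Rightarrow> 'a cotree" where
  "cotree_of (BLeaf v) = Leaf v"
| "cotree_of (BNode l a b) = Node l [cotree_of a, cotree_of b]"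

primrec order :: "'a bcotree \<Rightarrow> nat" where
  "order (BLeaf v) = 1"
| "order (BNode l a b) = order a + order b"

primrec disjoint_leaves :: "'a bcotree \<Rightarrow> bool" where
  "disjoint_leaves (BLeaf v) \<longleftrightarrow> True"
| "disjoint_leaves (BNode l a b) \<longleftrightarrow>
     disjoint_leaves a \<and> disjoint_leaves b \<and> bverts a \<inter> bverts b = {}"

primrec adj :: "'a bcotree \<Rightarrow> 'a \<Rightarrow> 'a \<Rightarrow> bool" where
  "adj (BLeaf x) u v \<longleftrightarrow> False"
| "adj (BNode l a b) u v \<longleftrightarrow> adj a u v \<or> adj b u v \<or>
     l = Oplus \<and> (u \<in> bverts a \<and> v \<in> bverts b \<or> u \<in> bverts b \<and> v \<in> bverts a)"

primrec chi :: "'a bcotree \<Rightarrow> nat" where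
  "chi (BLeaf v) = 1"
| "chi (BNode l a b) =
     (if l = Cup then max (chi a) (chi b) else min (chi a + order b) (chi b + order a))"

lemma finite_bverts [simp]: "finite (bverts t)"
  by (induction t) auto

lemma order_pos [simp]: "0 < order t"
  by (induction t) auto

lemma chi_le_order: "chi t \<le> order t"
  by (induction t) auto

lemma card_bverts: "disjoint_leaves t \<Longrightarrow> card (bverts t) = order t"
  by (induction t) (auto simp: card_Un_disjoint)

lemma set_leaves_cotree_of [simp]: "set (leaves (cotree_of t)) = bverts t"
  by (induction t) auto

lemma distinct_leaves_cotree_of: "distinct (leaves (cotree_of t)) \<longleftrightarrow> disjoint_leaves t"
  by (induction t) auto

lemma binary_imp_cotree_of: "binary T \<Longrightarrow> \<exists>t. T = cotree_of t"
proof (induction T)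
  case (Leaf x)
  have "Leaf x = cotree_of (BLeaf x)" by simp
  then show ?case ..
next
  case (Node l ts)
  have "length ts = 2" using Node.prems by (auto simp: binary_def)
  then obtain A B where ts: "ts = [A, B]"
    by (auto simp: numeral_2_eq_2 length_Suc_conv)
  have "binary A" "binary B" using Node.prems by (auto simp: binary_def ts)
  then obtain a b where "A = cotree_of a" "B = cotree_of b"
    using Node.IH[of A] Node.IH[of B] ts by auto
  then have "Node l ts = cotree_of (BNode l a b)" using ts by simp
  then show ?case ..
qed

lemma adj_bverts: "adj t u v \<Longrightarrow> u \<in> bverts t \<and> v \<in> bverts t"
  by (induction t) auto

lemma adj_sym: "adj t u v \<Longrightarrow> adj t v u"
  by (induction t) auto

lemma adj_irrefl: "disjoint_leaves t \<Longrightarrow> \<not> adj t u u"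
  by (induction t) auto

section \<open>Lowest common ancestors and adjacency\<close>

lemma self_in_subtrees [simp]: "T \<in> subtrees T"
  by (cases T) auto

lemma leaves_subtrees: "S \<in> subtrees T \<Longrightarrow> set (leaves S) \<subseteq> set (leaves T)"
  by (induction T) auto

text \<open>Makes lowest common ancestors recursive: the minimality of the root fails exactly when
  some child contains both leaves.\<close>

lemma is_lca_Node2:
  "is_lca (Node l [A, B]) u v S \<longleftrightarrow> is_lca A u v S \<or> is_lca B u v S \<or>
     S = Node l [A, B] \<and> {u, v} \<subseteq> set (leaves A) \<union> set (leaves B) \<and>
     \<not> {u, v} \<subseteq> set (leaves A) \<and> \<not> {u, v} \<subseteq> set (leaves B)"
  (is "?L \<longleftrightarrow> ?R")
proof
  let ?T = "Node l [A, B]"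
  assume L: ?L
  have A: "A \<in> subtrees ?T" "A \<noteq> ?T" and B: "B \<in> subtrees ?T" "B \<noteq> ?T"
    by (auto dest: arg_cong[where f = size])
  show ?R
  proof (cases "S = ?T")
    case True
    with L have "\<forall>S' \<in> subtrees ?T. u \<in> set (leaves S') \<and> v \<in> set (leaves S') \<longrightarrow> S' = ?T"
      unfolding is_lca_def by blast
    with A B have "\<not> {u, v} \<subseteq> set (leaves A)" "\<not> {u, v} \<subseteq> set (leaves B)" by blast+
    moreover have "{u, v} \<subseteq> set (leaves A) \<union> set (leaves B)"
      using L True by (auto simp: is_lca_def)
    ultimately show ?thesis using True by blast
  next
    case False
    with L show ?thesis by (auto simp: is_lca_def)
  qed
next
  assume ?R
  then show ?L
    by (auto simp: is_lca_def; blast dest: leaves_subtrees)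
qed

lemma lca_Oplus_iff_adj:
  "disjoint_leaves t \<Longrightarrow> (\<exists>ts. is_lca (cotree_of t) u v (Node Oplus ts)) \<longleftrightarrow> adj t u v"
proof (induction t)
  case (BLeaf x)
  then show ?case by (simp add: is_lca_def)
next
  case (BNode l a b)
  have "(\<exists>ts. is_lca (cotree_of (BNode l a b)) u v (Node Oplus ts)) \<longleftrightarrow>
    adj a u v \<or> adj b u v \<or> l = Oplus \<and> {u, v} \<subseteq> bverts a \<union> bverts b \<and>
     \<not> {u, v} \<subseteq> bverts a \<and> \<not> {u, v} \<subseteq> bverts b"
    using BNode by (auto simp: is_lca_Node2 simp flip: BNode.IH)
  \<comment> \<open>A pair contained in neither child is split between them; the converse holds
    because the children share no leaf.\<close>
  then show ?case using BNode.prems by auto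
qed

text \<open>\<open>is_cotree\<close> constrains only pairs of distinct vertices; this rules out any
  other sets in \<open>edges G\<close>.\<close>

lemma cograph_edge: "cograph G \<Longrightarrow> e \<in> edges G \<Longrightarrow> \<exists>u\<in>verts G. \<exists>v\<in>verts G. u \<noteq> v \<and> e = {u, v}"
proof (induction rule: cograph.induct)
  case (union G H)
  then have "e \<in> edges G \<or> e \<in> edges H" by (simp add: graph_union_def)
  with union.IH show ?case by (fastforce simp: graph_union_def)
next
  case (join G H)
  then consider "e \<in> edges G \<or> e \<in> edges H" | u v where "e = {u, v}" "u \<in> verts G" "v \<in> verts H"
    by (auto simp: graph_join_def)
  then show ?case
  proof cases
    case 1
    with join.IH show ?thesis by (fastforce simp: graph_join_def)
  next
    case 2
    moreover from this have "u \<noteq> v" using join.hyps by blast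
    ultimately show ?thesis by (auto simp: graph_join_def)
  qed
qed simp

text \<open>The only link between tree and graph that the coloring arguments use.\<close>

definition represents :: "'a bcotree \<Rightarrow> 'a graph \<Rightarrow> bool" where
  "represents t G \<longleftrightarrow> disjoint_leaves t \<and> verts G = bverts t \<and> edges G = {{u, v} |u v. adj t u v}"

lemma represents_edge_iff: "represents t G \<Longrightarrow> {u, v} \<in> edges G \<longleftrightarrow> adj t u v"
  by (auto simp: represents_def doubleton_eq_iff dest: adj_sym)

lemma is_cotree_represents:
  assumes "cograph G" and "is_cotree (cotree_of t) G"
  shows "represents t G"
proof -
  have d: "disjoint_leaves t" and V: "verts G = bverts t"
    using assms(2) by (auto simp: is_cotree_def distinct_leaves_cotree_of)
  have adj: "{u, v} \<in> edges G \<longleftrightarrow> adj t u v" if "u \<in> verts G" "v \<in> verts G" "u \<noteq> v" for u v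
    using assms(2) that lca_Oplus_iff_adj[OF d] by (auto simp: is_cotree_def)
  have "edges G = {{u, v} |u v. adj t u v}"
  proof (intro equalityI subsetI)
    fix e assume "e \<in> edges G"
    then show "e \<in> {{u, v} |u v. adj t u v}"
      using cograph_edge[OF assms(1)] adj by blast
  next
    fix e assume "e \<in> {{u, v} |u v. adj t u v}"
    then obtain u v where "e = {u, v}" "adj t u v" by blast
    then show "e \<in> edges G"
      using adj[of u v] adj_bverts[of t u v] adj_irrefl[OF d] V by metis
  qed
  with d V show ?thesis by (simp add: represents_def)
qed

section \<open>Bichromatic paths and cycles\<close>

definition proper :: "('a \<Rightarrow> 'a \<Rightarrow> bool) \<Rightarrow> ('a \<Rightarrow> nat) \<Rightarrow> bool" where
  "proper E f \<longleftrightarrow> (\<forall>u v. E u v \<longrightarrow> f u \<noteq> f v)"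

text \<open>The quantifiers range over walks; \<open>a = c\<close> and \<open>b = d\<close> admit
  those that turn back. Under \<open>proper\<close> the excluded ones have four distinct vertices.
  Acyclic and star colorings both satisfy this, which yields the lower bound.\<close>

definition C4_free :: "('a \<Rightarrow> 'a \<Rightarrow> bool) \<Rightarrow> ('a \<Rightarrow> nat) \<Rightarrow> bool" where
  "C4_free E f \<longleftrightarrow> (\<forall>a b c d. E a b \<and> E b c \<and> E c d \<and> E d a \<and> f a = f c \<and> f b = f d
     \<longrightarrow> a = c \<or> b = d)"

text \<open>The stronger counterpart, sufficient for a proper coloring to be acyclic and star. The
  path need not be induced.\<close>

definition P4_free :: "('a \<Rightarrow> 'a \<Rightarrow> bool) \<Rightarrow> ('a \<Rightarrow> nat) \<Rightarrow> bool" where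
  "P4_free E f \<longleftrightarrow> (\<forall>a b c d. E a b \<and> E b c \<and> E c d \<and> f a = f c \<and> f b = f d
     \<longrightarrow> a = c \<or> b = d)"

lemma proper_coloring_iff:
  "represents t G \<Longrightarrow> proper_coloring G f \<longleftrightarrow> proper (adj t) f"
  by (simp add: proper_coloring_def proper_def represents_edge_iff)

lemma induced_edge_iff:
  assumes "represents t G"
  shows "{u, v} \<in> edges (induced G (color_class G f i \<union> color_class G f j)) \<longleftrightarrow>
    adj t u v \<and> f u \<in> {i, j} \<and> f v \<in> {i, j}"
  using represents_edge_iff[OF assms, of u v] adj_bverts[of t u v] assms
  by (auto simp: induced_def color_class_def represents_def)

lemma acyclic_coloring_C4_free:
  assumes G: "represents t G" and f: "acyclic_coloring G f"
  shows "C4_free (adj t) f"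
  unfolding C4_free_def
proof (intro allI impI, rule ccontr)
  fix a b c d
  assume *: "adj t a b \<and> adj t b c \<and> adj t c d \<and> adj t d a \<and> f a = f c \<and> f b = f d"
    and ne: "\<not> (a = c \<or> b = d)"
  let ?H = "induced G (color_class G f (f a) \<union> color_class G f (f b))"
  have V: "{a, b, c, d} \<subseteq> verts G"
    using * adj_bverts[of t] G by (auto simp: represents_def)
  have p: "proper (adj t) f"
    using f proper_coloring_iff[OF G] by (simp add: acyclic_coloring_def)
  have fab: "f a \<noteq> f b" using * p by (simp add: proper_def)
  \<comment> \<open>Neighbors on the cycle differ in color, opposite vertices differ by
    \<open>ne\<close>.\<close>
  have dist: "distinct [a, b, c, d]" using * ne p by (auto simp: proper_def)
  have "is_cycle ?H [a, b, c, d]"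
    unfolding is_cycle_def
  proof (intro conjI allI impI)
    show "set [a, b, c, d] \<subseteq> verts ?H"
      using V * by (auto simp: induced_def color_class_def)
    fix k assume "k < length [a, b, c, d]"
    then consider "k = 0" | "k = 1" | "k = 2" | "k = 3" by fastforce
    then show "{[a, b, c, d] ! k, [a, b, c, d] ! (Suc k mod length [a, b, c, d])} \<in> edges ?H"
      by cases (use * in \<open>simp_all add: induced_edge_iff[OF G]\<close>)
  qed (use dist in auto)
  moreover have "forest ?H"
    using f V fab by (simp add: acyclic_coloring_def)
  ultimately show False by (auto simp: forest_def)
qed

text \<open>Both edges pass through the center. Opposite edges of a 4-cycle will contradict
  this.\<close>

lemma star_edges_meet:
  assumes "star H" "e \<in> edges H" "e' \<in> edges H"
  shows "e \<inter> e' \<noteq> {}"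
  using assms by (auto simp: star_def)

lemma star_coloring_C4_free:
  assumes G: "represents t G" and f: "star_coloring G f"
  shows "C4_free (adj t) f"
  unfolding C4_free_def
proof (intro allI impI, rule ccontr)
  fix a b c d
  assume *: "adj t a b \<and> adj t b c \<and> adj t c d \<and> adj t d a \<and> f a = f c \<and> f b = f d"
    and ne: "\<not> (a = c \<or> b = d)"
  let ?H = "induced G (color_class G f (f a) \<union> color_class G f (f b))"
  have V: "{a, b, c, d} \<subseteq> verts G"
    using * adj_bverts[of t] G by (auto simp: represents_def)
  have p: "proper (adj t) f"
    using f proper_coloring_iff[OF G] by (simp add: star_coloring_def)
  have fab: "f a \<noteq> f b" using * p by (simp add: proper_def)
  have dist: "distinct [a, b, c, d]" using * ne p by (auto simp: proper_def)
  have "disjoint_union_of_stars ?H"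
    using f V fab by (simp add: star_coloring_def)
  then obtain P where P: "partition_on (verts ?H) P"
    and stars: "\<And>A. A \<in> P \<Longrightarrow> star (induced ?H A)"
    and edges: "edges ?H = (\<Union>A\<in>P. edges (induced ?H A))"
    by (auto simp: disjoint_union_of_stars_def)
  have part: "\<exists>A\<in>P. e \<in> edges (induced ?H A) \<and> e \<subseteq> A" if "e \<in> edges ?H" for e
    using that[unfolded edges] by (auto simp: induced_def)
  have E: "{a, b} \<in> edges ?H" "{b, c} \<in> edges ?H" "{c, d} \<in> edges ?H"
    using * by (auto simp: induced_edge_iff[OF G])
  obtain A where A: "A \<in> P" "{a, b} \<in> edges (induced ?H A)" "{a, b} \<subseteq> A"
    using part[OF E(1)] by blast
  obtain B where B: "B \<in> P" "{b, c} \<subseteq> B"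
    using part[OF E(2)] by blast
  obtain C where C: "C \<in> P" "{c, d} \<in> edges (induced ?H C)" "{c, d} \<subseteq> C"
    using part[OF E(3)] by blast
  \<comment> \<open>Blocks sharing a vertex coincide, so \<open>{a, b}\<close> and
    \<open>{c, d}\<close> lie in one star and would have to meet.\<close>
  have "A = B" using A B partition_onD2[OF P] by (auto simp: disjoint_def)
  moreover have "B = C" using C B partition_onD2[OF P] by (auto simp: disjoint_def)
  ultimately have "{a, b} \<inter> {c, d} \<noteq> {}"
    using star_edges_meet[OF stars[OF A(1)]] A C by blast
  then show False using dist by auto
qed

text \<open>A bichromatic cycle cannot be a triangle, and a longer one contains a path on four
  vertices.\<close>

lemma P4_free_acyclic_coloring:
  assumes G: "represents t G" and p: "proper (adj t) f" and P4: "P4_free (adj t) f"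
  shows "acyclic_coloring G f"
  unfolding acyclic_coloring_def
proof (intro conjI ballI impI)
  show "proper_coloring G f" using p proper_coloring_iff[OF G] by simp
  fix i j :: nat assume "i \<noteq> j"
  let ?H = "induced G (color_class G f i \<union> color_class G f j)"
  show "forest ?H"
    unfolding forest_def
  proof
    assume "\<exists>xs. is_cycle ?H xs"
    then obtain xs where len: "3 \<le> length xs" and dist: "distinct xs"
      and E: "\<And>k. k < length xs \<Longrightarrow> {xs ! k, xs ! (Suc k mod length xs)} \<in> edges ?H"
      by (auto simp: is_cycle_def)
    have E': "adj t (xs ! k) (xs ! (Suc k mod length xs)) \<and>
        f (xs ! k) \<in> {i, j} \<and> f (xs ! (Suc k mod length xs)) \<in> {i, j}" if "k < length xs" for k
      using E[OF that] unfolding induced_edge_iff[OF G] .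
    have f_ne: "f u \<noteq> f v" if "adj t u v" for u v
      using p that by (simp add: proper_def)
    have e0: "adj t (xs ! 0) (xs ! 1)" "f (xs ! 0) \<in> {i, j}" "f (xs ! 1) \<in> {i, j}"
      and e1: "adj t (xs ! 1) (xs ! 2)" "f (xs ! 2) \<in> {i, j}"
      using E'[of 0] E'[of 1] len by (simp_all add: numeral_2_eq_2 flip: length_greater_0_conv)
    have f02: "f (xs ! 0) = f (xs ! 2)"
      using e0 e1 f_ne[OF e0(1)] f_ne[OF e1(1)] by auto
    show False
    proof (cases "length xs = 3")
      case True
      then have "adj t (xs ! 2) (xs ! 0)" using E'[of 2] by simp
      then show False using f02 f_ne by metis
    next
      case False
      then have e2: "adj t (xs ! 2) (xs ! 3)" "f (xs ! 3) \<in> {i, j}"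
        using E'[of 2] len by (auto simp: numeral_3_eq_3 numeral_2_eq_2)
      have "f (xs ! 1) = f (xs ! 3)"
        using e0 e1 e2 f_ne[OF e1(1)] f_ne[OF e2(1)] by auto
      then have "xs ! 0 = xs ! 2 \<or> xs ! 1 = xs ! 3"
        using P4 e0 e1 e2 f02 unfolding P4_free_def by blast
      then show False using len False nth_eq_iff_index_eq[OF dist, of 0 2] nth_eq_iff_index_eq[OF dist, of 1 3]
          by linarith
    qed
  qed
qed

text \<open>The blocks are the centers in \<open>C\<close> with their neighbors. By independence a
  center lies only in its own block, and any other vertex lies only in that of its unique neighbor.
  Isolated vertices count as centers.\<close>

lemma disjoint_union_of_starsI:
  assumes edge: "\<And>e. e \<in> edges H \<Longrightarrow> \<exists>u v. e = {u, v} \<and> u \<in> verts H \<and> v \<in> verts H \<and> u \<noteq> v"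
    and C: "C \<subseteq> verts H"
    and indep: "\<And>u v. u \<in> C \<Longrightarrow> v \<in> C \<Longrightarrow> {u, v} \<notin> edges H"
    and leaf: "\<And>v. v \<in> verts H - C \<Longrightarrow> \<exists>c\<in>C. \<forall>u. {v, u} \<in> edges H \<longleftrightarrow> u = c"
  shows "disjoint_union_of_stars H"
proof -
  define S where "S c = insert c {v. {v, c} \<in> edges H}" for c
  have S_verts: "S c \<subseteq> verts H" if "c \<in> C" for c
    using that C edge by (fastforce simp: S_def doubleton_eq_iff)
  have S_inj: "c = c'" if "c \<in> C" "c' \<in> C" "v \<in> S c" "v \<in> S c'" for c c' v
  proof (cases "v \<in> C")
    case True
    then have "v = c" "v = c'" using that indep by (auto simp: S_def)
    then show ?thesis by simp
  next
    case False
    then have "{v, c} \<in> edges H" "{v, c'} \<in> edges H" "v \<in> verts H"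
      using that S_verts by (auto simp: S_def)
    then show ?thesis using leaf[of v] False by (metis Diff_iff)
  qed
  have part: "partition_on (verts H) (S ` C)"
  proof (rule partition_onI)
    show "\<Union> (S ` C) = verts H"
    proof
      show "\<Union> (S ` C) \<subseteq> verts H" using S_verts by blast
      show "verts H \<subseteq> \<Union> (S ` C)"
        using leaf by (fastforce simp: S_def)
    qed
    show "disjnt p q" if "p \<in> S ` C" "q \<in> S ` C" "p \<noteq> q" for p q
      using that S_inj by (auto simp: disjnt_def)
    show "{} \<notin> S ` C"
      by (auto simp: S_def)
  qed
  have star_edge: "\<exists>c\<in>C. \<exists>v. e = {c, v} \<and> v \<notin> C \<and> v \<in> S c" if e: "e \<in> edges H" for e
  proof -
    obtain u v where uv: "e = {u, v}" "u \<in> verts H" "v \<in> verts H" "u \<noteq> v"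
      using edge[OF e] by blast
    \<comment> \<open>By independence one end lies outside \<open>C\<close>, and its only neighbor
      is a center.\<close>
    have "u \<notin> C \<or> v \<notin> C" using indep e uv(1) by blast
    then obtain x y where xy: "e = {x, y}" "x \<in> verts H" "x \<notin> C"
      using uv by (metis insert_commute)
    then obtain c where "c \<in> C" "y = c" using leaf[of x] e by blast
    then show ?thesis using xy e by (auto simp: S_def insert_commute)
  qed
  have stars: "star (induced H (S c))" if c: "c \<in> C" for c
    unfolding star_def
  proof (intro bexI equalityI subsetI)
    show "c \<in> verts (induced H (S c))"
      using c C by (auto simp: induced_def S_def)
    fix e assume "e \<in> edges (induced H (S c))"
    then have e: "e \<in> edges H" "e \<subseteq> S c" by (auto simp: induced_def)
    then obtain c' v where v: "c' \<in> C" "e = {c', v}" "v \<notin> C" "v \<in> S c'"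
      using star_edge by blast
    then have "c' = c" using S_inj[of c' c v] c e by auto
    then show "e \<in> {{c, x} |x. x \<in> verts (induced H (S c)) - {c}}"
      using v S_verts[OF c] c by (auto simp: induced_def)
  next
    fix e assume "e \<in> {{c, x} |x. x \<in> verts (induced H (S c)) - {c}}"
    then show "e \<in> edges (induced H (S c))"
      by (auto simp: induced_def S_def insert_commute)
  qed
  have "edges H = (\<Union>A\<in>S ` C. edges (induced H A))"
  proof (intro equalityI subsetI)
    fix e assume e: "e \<in> edges H"
    then obtain c v where "c \<in> C" "e = {c, v}" "v \<in> S c"
      using star_edge by blast
    then show "e \<in> (\<Union>A\<in>S ` C. edges (induced H A))"
      using e by (auto simp: induced_def S_def)
  qed (auto simp: induced_def)
  with part stars show ?thesis
    unfolding disjoint_union_of_stars_def by blast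
qed

text \<open>Without a path on four vertices, every edge between two classes has an end with no
  further neighbor there. Such ends become leaves and the other vertices centers; an isolated edge
  needs a tie-break by color.\<close>

lemma P4_free_star_coloring:
  assumes G: "represents t G" and p: "proper (adj t) f" and P4: "P4_free (adj t) f"
  shows "star_coloring G f"
  unfolding star_coloring_def
proof (intro conjI ballI impI)
  show "proper_coloring G f" using p proper_coloring_iff[OF G] by simp
  fix i j :: nat assume "i \<noteq> j"
  define H where "H = induced G (color_class G f i \<union> color_class G f j)"
  define E where "E u v \<longleftrightarrow> {u, v} \<in> edges H" for u v
  have E_iff: "E u v \<longleftrightarrow> adj t u v \<and> f u \<in> {i, j} \<and> f v \<in> {i, j}" for u v
    unfolding E_def H_def by (rule induced_edge_iff[OF G])
  have verts_H: "v \<in> verts H \<longleftrightarrow> v \<in> bverts t \<and> f v \<in> {i, j}" for v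
    using G by (auto simp: H_def induced_def color_class_def represents_def)
  have E_sym: "E u v \<Longrightarrow> E v u" for u v by (auto simp: E_iff dest: adj_sym)
  have E_color: "E u v \<Longrightarrow> f u \<noteq> f v" for u v using p by (auto simp: E_iff proper_def)
  \<comment> \<open>Within two classes the colors alternate along every walk, which supplies the
    color equations of \<open>P4_free\<close>.\<close>
  have E_P4: "a = c \<or> b = d" if "E a b" "E b c" "E c d" for a b c d
  proof -
    have "f a = f c" "f b = f d"
      using that E_color[of a b] E_color[of b c] E_color[of c d] by (auto simp: E_iff)
    then show ?thesis using that P4 unfolding P4_free_def E_iff by blast
  qed
  \<comment> \<open>Vertices of degree one; in a component that is a single edge, only the end colored \<open>j\<close>.\<close>
  define L where "L = {v. \<exists>u. (\<forall>x. E v x \<longleftrightarrow> x = u) \<and> ((\<exists>x. E u x \<and> x \<noteq> v) \<or> f v = j)}"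
  have "disjoint_union_of_stars H"
  proof (rule disjoint_union_of_starsI[of H "verts H - L"])
    fix e assume "e \<in> edges H"
    moreover from this have "e \<in> edges G" by (simp add: H_def induced_def)
    then obtain u v where uv: "e = {u, v}" using G by (auto simp: represents_def)
    ultimately have "E u v" by (simp add: E_def)
    then show "\<exists>u v. e = {u, v} \<and> u \<in> verts H \<and> v \<in> verts H \<and> u \<noteq> v"
      using uv E_color[of u v] adj_bverts[of t u v] unfolding E_iff verts_H by blast
  next
    fix u v assume uv: "u \<in> verts H - L" "v \<in> verts H - L"
    show "{u, v} \<notin> edges H"
    proof
      assume "{u, v} \<in> edges H"
      then have E: "E u v" "E v u" by (auto simp: E_def insert_commute)
      \<comment> \<open>Further neighbors at both ends would extend the edge to a path excluded by
        \<open>E_P4\<close>.\<close>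
      have "(\<forall>x. E u x \<longleftrightarrow> x = v) \<or> (\<forall>x. E v x \<longleftrightarrow> x = u)"
        using E E_P4 E_sym by metis
      \<comment> \<open>A further neighbor at one end would put the other end into \<open>L\<close>,
        so the edge is isolated. Then neither end has color \<open>j\<close>, and both would have
        color \<open>i\<close>.\<close>
      then have "(\<forall>x. E u x \<longleftrightarrow> x = v) \<and> (\<forall>x. E v x \<longleftrightarrow> x = u)"
        using E uv unfolding L_def by blast
      then have "f u \<noteq> j" "f v \<noteq> j" using uv unfolding L_def by blast+
      then show False using E E_color[of u v] by (auto simp: E_iff)
    qed
  next
    fix v assume v: "v \<in> verts H - (verts H - L)"
    then obtain u where u: "\<And>x. E v x \<longleftrightarrow> x = u" and u': "(\<exists>x. E u x \<and> x \<noteq> v) \<or> f v = j"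
      unfolding L_def by blast
    have Evu: "E v u" using u by simp
    \<comment> \<open>Otherwise the edge would be isolated with both ends colored
      \<open>j\<close>.\<close>
    have "u \<notin> L"
    proof
      assume "u \<in> L"
      then obtain z where z: "\<And>x. E u x \<longleftrightarrow> x = z" "(\<exists>x. E z x \<and> x \<noteq> u) \<or> f u = j"
        unfolding L_def by blast
      have "z = v" using E_sym[OF Evu] z(1) by simp
      then have "\<And>x. E u x \<longleftrightarrow> x = v" "f u = j" using z u by simp_all
      then show False using u' E_color[OF Evu] by auto
    qed
    moreover have "u \<in> verts H"
      using Evu adj_bverts[of t v u] by (simp add: E_iff verts_H)
    ultimately show "\<exists>c\<in>verts H - L. \<forall>u. {v, u} \<in> edges H \<longleftrightarrow> u = c"
      using u unfolding E_def by blast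
  qed auto
  then show "disjoint_union_of_stars (induced G (color_class G f i \<union> color_class G f j))"
    unfolding H_def .
qed

section \<open>The optimal coloring\<close>

lemma C4_free_join_inj:
  assumes "C4_free (adj (BNode Oplus a b)) f"
  shows "inj_on f (bverts a) \<or> inj_on f (bverts b)"
proof (rule ccontr)
  assume "\<not> ?thesis"
  then obtain u v x y where "u \<in> bverts a" "v \<in> bverts a" "u \<noteq> v" "f u = f v"
    "x \<in> bverts b" "y \<in> bverts b" "x \<noteq> y" "f x = f y"
    by (auto simp: inj_on_def)
  then show False
    \<comment> \<open>Equal colors sit at opposite corners, so all four sides of this cycle are join
      edges.\<close>
    using assms[unfolded C4_free_def, rule_format, of u x v y] by auto
qed

text \<open>Using \<open>C4_free\<close> covers acyclic and star colorings at once. At a join the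
  color counts of the sides add up, and an injective side contributes its full order.\<close>

lemma chi_lower_bound:
  "disjoint_leaves t \<Longrightarrow> proper (adj t) f \<Longrightarrow> C4_free (adj t) f \<Longrightarrow> chi t \<le> card (f ` bverts t)"
proof (induction t)
  case (BLeaf x)
  then show ?case by simp
next
  case (BNode l a b)
  have IH: "chi a \<le> card (f ` bverts a)" "chi b \<le> card (f ` bverts b)"
    using BNode by (auto simp: proper_def C4_free_def)
  show ?case
  proof (cases l)
    case Cup
    have "card (f ` bverts a) \<le> card (f ` (bverts a \<union> bverts b))"
      "card (f ` bverts b) \<le> card (f ` (bverts a \<union> bverts b))"
      by (auto intro!: card_mono)
    with IH Cup show ?thesis by auto
  next
    case Oplus
    have "f ` bverts a \<inter> f ` bverts b = {}"
      using BNode.prems(2) Oplus by (fastforce simp: proper_def)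
    then have card: "card (f ` (bverts a \<union> bverts b)) = card (f ` bverts a) + card (f ` bverts b)"
      by (simp add: image_Un card_Un_disjoint)
    have "card (f ` bverts a) = order a \<or> card (f ` bverts b) = order b"
      using C4_free_join_inj[of a b f] BNode.prems unfolding Oplus
      by (metis card_bverts card_image disjoint_leaves.simps(2))
    with IH card Oplus show ?thesis by auto
  qed
qed

section \<open>A coloring attaining the bound\<close>

text \<open>\<open>color t r k\<close> colors \<open>t\<close> with consecutive colors from \<open>k\<close> on: pairwise distinct ones if
  \<open>r\<close>, and \<open>chi t\<close> many otherwise.\<close>

primrec color :: "'a bcotree \<Rightarrow> bool \<Rightarrow> nat \<Rightarrow> 'a \<Rightarrow> nat" where
  "color (BLeaf x) r k v = k"
| "color (BNode l a b) r k v =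
    (if r then if v \<in> bverts a then color a True k v else color b True (k + order a) v
     else if l = Cup then if v \<in> bverts a then color a False k v else color b False k v
     else if chi a + order b < chi b + order a
     then if v \<in> bverts a then color a False k v else color b True (k + chi a) v
     else if v \<in> bverts a then color a True (k + chi b) v else color b False k v)"

text \<open>For disjoint leaves, the length of the color interval that \<open>color t r k\<close>
  occupies.\<close>

definition ncolors :: "bool \<Rightarrow> 'a bcotree \<Rightarrow> nat" where
  "ncolors r t = (if r then order t else chi t)"

text \<open>In a non-rainbow union both intervals start at \<open>k\<close> and the longer covers
  the other; in all other nodes the intervals of the children are adjacent.\<close>

lemma color_image:
  "disjoint_leaves t \<Longrightarrow> color t r k ` bverts t = {k..<k + ncolors r t}"
proof (induction t arbitrary: r k)
  case (BLeaf x)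
  then show ?case by (auto simp: ncolors_def)
next
  case (BNode l a b)
  have not_a: "v \<in> bverts b \<Longrightarrow> v \<notin> bverts a" for v using BNode.prems by auto
  have IHa: "color a r k ` bverts a = {k..<k + ncolors r a}"
    and IHb: "color b r k ` bverts b = {k..<k + ncolors r b}" for r k
    using BNode by auto
  consider r | "\<not> r" "l = Cup" | "\<not> r" "l = Oplus" "chi a + order b < chi b + order a"
    | "\<not> r" "l = Oplus" "\<not> chi a + order b < chi b + order a"
    by (cases l) auto
  then show ?case
    by cases (auto simp add: image_Un not_a IHa IHb ncolors_def max_def min_def
        cong: image_cong simp del: if_image_distrib)
qed

lemma color_rainbow_inj: "disjoint_leaves t \<Longrightarrow> inj_on (color t True k) (bverts t)"
  by (rule eq_card_imp_inj_on) (simp_all add: color_image card_bverts ncolors_def)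

text \<open>The coloring of a node agrees with that of a child only on the child's vertices.\<close>

lemma P4_free_cong:
  assumes "\<And>v. v \<in> bverts t \<Longrightarrow> f v = g v"
  shows "P4_free (adj t) f \<longleftrightarrow> P4_free (adj t) g" and "proper (adj t) f \<longleftrightarrow> proper (adj t) g"
  using assms adj_bverts[of t] unfolding P4_free_def proper_def by (metis, metis)

lemma P4_free_union:
  assumes "disjoint_leaves (BNode Cup a b)"
    "proper (adj a) f" "P4_free (adj a) f" "proper (adj b) f" "P4_free (adj b) f"
  shows "proper (adj (BNode Cup a b)) f \<and> P4_free (adj (BNode Cup a b)) f"
proof
  show "proper (adj (BNode Cup a b)) f"
    using assms by (auto simp: proper_def)
  \<comment> \<open>Edges of different children never share a vertex, so a path stays within one
    child.\<close>
  have "\<not> (adj a u v \<and> adj b v w)" "\<not> (adj b u v \<and> adj a v w)" for u v w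
    using assms(1) adj_bverts[of a] adj_bverts[of b] by fastforce+
  then show "P4_free (adj (BNode Cup a b)) f"
    using assms(3,5) unfolding P4_free_def adj.simps by (metis label.distinct(1))
qed

text \<open>Colors repeat only inside \<open>a\<close>. Every vertex of a bichromatic path on four
  vertices shares its color with another one, so the path would lie in \<open>a\<close>.\<close>

lemma P4_free_join:
  assumes d: "disjoint_leaves (BNode Oplus a b)"
    and a: "proper (adj a) f" "P4_free (adj a) f" and b: "inj_on f (bverts b)"
    and ab: "f ` bverts a \<inter> f ` bverts b = {}"
  shows "proper (adj (BNode Oplus a b)) f \<and> P4_free (adj (BNode Oplus a b)) f"
proof
  have ne: "f u \<noteq> f v" if "u \<in> bverts a" "v \<in> bverts b" for u v
    using that ab by blast
  have "f u \<noteq> f v" if "adj b u v" for u v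
    using that b adj_bverts[OF that] adj_irrefl[of b u] d by (auto dest: inj_onD)
  with a ne ne[symmetric] show "proper (adj (BNode Oplus a b)) f"
    by (auto simp: proper_def)
  have same: "u \<in> bverts a \<and> v \<in> bverts a"
    if "f u = f v" "u \<noteq> v" "u \<in> bverts a \<union> bverts b" "v \<in> bverts a \<union> bverts b" for u v
    using that ne[of u v] ne[of v u] b by (auto dest: inj_onD)
  show "P4_free (adj (BNode Oplus a b)) f"
    unfolding P4_free_def
  proof (intro allI impI, rule ccontr)
    fix u x v y
    assume *: "adj (BNode Oplus a b) u x \<and> adj (BNode Oplus a b) x v \<and> adj (BNode Oplus a b) v y \<and>
      f u = f v \<and> f x = f y" and n: "\<not> (u = v \<or> x = y)"
    then have "u \<in> bverts (BNode Oplus a b)" "x \<in> bverts (BNode Oplus a b)"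
      "v \<in> bverts (BNode Oplus a b)" "y \<in> bverts (BNode Oplus a b)"
      using adj_bverts by metis+
    then have "{u, x, v, y} \<subseteq> bverts a" using same[of u v] same[of x y] * n by auto
    moreover from this have "w \<notin> bverts b" if "w \<in> {u, x, v, y}" for w
      using d that by auto
    ultimately have "adj a u x" "adj a x v" "adj a v y"
      using * adj_bverts[of b] by auto
    then show False using a(2) * n unfolding P4_free_def by blast
  qed
qed

lemma adj_BNode_commute: "adj (BNode l a b) = adj (BNode l b a)"
  by (auto simp: fun_eq_iff)

lemma color_P4_free:
  "disjoint_leaves t \<Longrightarrow> proper (adj t) (color t r k) \<and> P4_free (adj t) (color t r k)"
proof (induction t arbitrary: r k)
  case (BLeaf x)
  then show ?case by (simp add: proper_def P4_free_def)
next
  case (BNode l a b)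
  let ?f = "color (BNode l a b) r k"
  have d: "bverts a \<inter> bverts b = {}" "disjoint_leaves a" "disjoint_leaves b"
    using BNode.prems by auto
  have fb: "v \<notin> bverts a" if "v \<in> bverts b" for v using d that by blast
  consider r | "\<not> r" "l = Cup" | "\<not> r" "l = Oplus" "chi a + order b < chi b + order a"
    | "\<not> r" "l = Oplus" "\<not> chi a + order b < chi b + order a"
    by (cases l) auto
  then show ?case
  proof cases
    case 1
    \<comment> \<open>An injective coloring has no repeated color at all.\<close>
    have "inj_on ?f (bverts (BNode l a b))"
      using color_rainbow_inj[OF BNode.prems] 1 by simp
    then show ?thesis
      using adj_irrefl[OF BNode.prems] adj_bverts[of "BNode l a b"]
      unfolding proper_def P4_free_def inj_on_def by metis
  next
    case 2
    have "?f v = color a False k v" if "v \<in> bverts a" for v using that 2 by simp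
    moreover have "?f v = color b False k v" if "v \<in> bverts b" for v using fb that 2 by simp
    ultimately show ?thesis
      using P4_free_union[of a b ?f] BNode 2 d P4_free_cong[of a ?f] P4_free_cong[of b ?f] by metis
  next
    case 3
    have fa: "?f v = color a False k v" if "v \<in> bverts a" for v using that 3 by simp
    have fb: "?f v = color b True (k + chi a) v" if "v \<in> bverts b" for v using fb that 3 by simp
    have "?f ` bverts a = {k..<k + chi a}" "?f ` bverts b = {k + chi a..<k + chi a + order b}"
      using color_image[OF d(2)] color_image[OF d(3)] fa fb by (simp_all add: ncolors_def cong: image_cong)
    then have "?f ` bverts a \<inter> ?f ` bverts b = {}" by simp
    moreover have "inj_on ?f (bverts b)"
      using color_rainbow_inj[OF d(3)] fb inj_on_cong by metis
    ultimately show ?thesis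
      using P4_free_join[of a b ?f] BNode 3 d P4_free_cong[of a ?f] fa by metis
  next
    case 4
    have fa: "?f v = color a True (k + chi b) v" if "v \<in> bverts a" for v using that 4 by simp
    have fb: "?f v = color b False k v" if "v \<in> bverts b" for v using fb that 4 by simp
    have "?f ` bverts a = {k + chi b..<k + chi b + order a}" "?f ` bverts b = {k..<k + chi b}"
      using color_image[OF d(2)] color_image[OF d(3)] fa fb by (simp_all add: ncolors_def cong: image_cong)
    then have "?f ` bverts b \<inter> ?f ` bverts a = {}" by simp
    moreover have "inj_on ?f (bverts a)"
      using color_rainbow_inj[OF d(2)] fa inj_on_cong by metis
    moreover have "disjoint_leaves (BNode Oplus b a)" using d by auto
    \<comment> \<open>Here \<open>b\<close> is the side that may reuse colors, so the join is taken
      in the other order.\<close>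
    ultimately have "proper (adj (BNode Oplus b a)) ?f \<and> P4_free (adj (BNode Oplus b a)) ?f"
      using P4_free_join[of b a ?f] BNode d P4_free_cong[of b ?f] fb by metis
    then show ?thesis using adj_BNode_commute[of Oplus a b] 4(2) by metis
  qed
qed

text \<open>Agreement on the vertices is all that is known of the output array. Both chromatic
  numbers equal \<open>chi t\<close>, since one lower bound serves both kinds of colorings.\<close>

lemma color_optimal:
  assumes G: "represents t G" and f: "\<And>v. v \<in> bverts t \<Longrightarrow> f v = color t False 0 v"
  shows "optimal_acyclic_coloring G f \<and> optimal_star_coloring G f"
proof -
  have d: "disjoint_leaves t" and V: "verts G = bverts t" using G by (auto simp: represents_def)
  have "proper (adj t) f" "P4_free (adj t) f"
    using color_P4_free[OF d] P4_free_cong[of t f "color t False 0"] f by blast+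
  then have colorings: "acyclic_coloring G f" "star_coloring G f"
    using P4_free_acyclic_coloring[OF G] P4_free_star_coloring[OF G] by blast+
  have n: "num_colors G f = chi t"
    using color_image[OF d, of False 0] f by (simp add: num_colors_def V ncolors_def cong: image_cong)
  have lower: "chi t \<le> num_colors G g" if "acyclic_coloring G g \<or> star_coloring G g" for g
  proof -
    have "proper_coloring G g" "C4_free (adj t) g"
      using that acyclic_coloring_C4_free[OF G] star_coloring_C4_free[OF G]
      by (auto simp: acyclic_coloring_def star_coloring_def)
    then show ?thesis
      using chi_lower_bound[OF d, of g] proper_coloring_iff[OF G] by (simp add: num_colors_def V)
  qed
  have "acyclic_chromatic_number G = chi t"
    unfolding acyclic_chromatic_number_def using colorings n lower by (auto intro!: Least_equality)
  moreover have "star_chromatic_number G = chi t"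
    unfolding star_chromatic_number_def using colorings n lower by (auto intro!: Least_equality)
  ultimately show ?thesis
    using colorings n by (simp add: optimal_acyclic_coloring_def optimal_star_coloring_def)
qed

section \<open>Loop-free programs and loops\<close>

primrec loop_free :: "com \<Rightarrow> bool" where
  "loop_free Skip \<longleftrightarrow> True"
| "loop_free (Assign r e) \<longleftrightarrow> True"
| "loop_free (Put a d e) \<longleftrightarrow> True"
| "loop_free (Seq P Q) \<longleftrightarrow> loop_free P \<and> loop_free Q"
| "loop_free (If b P Q) \<longleftrightarrow> loop_free P \<and> loop_free Q"
| "loop_free (While b P) \<longleftrightarrow> False"

primrec max_cost :: "com \<Rightarrow> nat" where
  "max_cost Skip = 1"
| "max_cost (Assign r e) = acost e + 1"
| "max_cost (Put a d e) = acost d + acost e + 1"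
| "max_cost (Seq P Q) = max_cost P + max_cost Q + 1"
| "max_cost (If b P Q) = bcost b + max (max_cost P) (max_cost Q) + 1"
| "max_cost (While b P) = 0"

text \<open>Turns loop-free execution into a function that the simplifier can evaluate. The values
  of \<open>run\<close> and \<open>max_cost\<close> at \<open>While\<close> are dummies.\<close>

primrec run :: "nat \<Rightarrow> com \<Rightarrow> state \<Rightarrow> state" where
  "run w Skip s = s"
| "run w (Assign r e) s = set_reg r (aval w e s) s"
| "run w (Put a d e) s = set_arr a (aval w d s) (aval w e s) s"
| "run w (Seq P Q) s = run w Q (run w P s)"
| "run w (If b P Q) s = (if bval w b s then run w P s else run w Q s)"
| "run w (While b P) s = s"

lemma exec_run: "loop_free P \<Longrightarrow> \<exists>t\<le>max_cost P. exec w P s t (run w P s)"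
proof (induction P arbitrary: s)
  case (Seq P Q)
  then obtain t t' where "t \<le> max_cost P" "exec w P s t (run w P s)"
    "t' \<le> max_cost Q" "exec w Q (run w P s) t' (run w Q (run w P s))"
    by (metis loop_free.simps(4))
  then show ?case
    using exec.Seq[of w P s t "run w P s" Q t'] by (intro exI[of _ "t + t' + 1"]) auto
next
  case (If b P Q)
  then obtain t t' where t: "t \<le> max_cost P" "exec w P s t (run w P s)"
    and t': "t' \<le> max_cost Q" "exec w Q s t' (run w Q s)"
    by (metis loop_free.simps(5))
  show ?case
  proof (cases "bval w b s")
    case True
    then show ?thesis using t exec.IfTrue[OF True t(2), of Q]
      by (intro exI[of _ "bcost b + t + 1"]) auto
  next
    case False
    then show ?thesis using t' exec.IfFalse[OF False t'(2), of P]
      by (intro exI[of _ "bcost b + t' + 1"]) auto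
  qed
next
  case Skip
  show ?case using exec.Skip[of w s] by auto
next
  case (Assign r e)
  show ?case using exec.Assign[of w r e s] by auto
next
  case (Put a d e)
  show ?case using exec.Put[of w a d e s] by auto
qed simp

text \<open>The measure bounds the number of rounds by \<open>m s\<close>; the added 1 pays for the
  final failing test.\<close>

lemma exec_While:
  assumes P: "loop_free P"
    and step: "\<And>s. I s \<Longrightarrow> bval w b s \<Longrightarrow> I (run w P s) \<and> m (run w P s) < m s"
    and "I s"
  shows "\<exists>t s'. exec w (While b P) s t s' \<and> t \<le> (m s + 1) * (bcost b + max_cost P + 1) \<and>
    I s' \<and> \<not> bval w b s'"
  using \<open>I s\<close>
proof (induction "m s" arbitrary: s rule: less_induct)
  case less
  let ?c = "bcost b + max_cost P + 1"
  show ?case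
  proof (cases "bval w b s")
    case False
    then show ?thesis using exec.WhileFalse[OF False, of P] less.prems by fastforce
  next
    case True
    let ?s = "run w P s"
    have I: "I ?s" "m ?s < m s" using step[OF less.prems True] by auto
    obtain t where t: "t \<le> max_cost P" "exec w P s t ?s" using exec_run[OF P] by blast
    obtain t' s' where t': "exec w (While b P) ?s t' s'" "t' \<le> (m ?s + 1) * ?c" "I s'" "\<not> bval w b s'"
      using less.hyps[OF I(2,1)] by blast
    have "(m ?s + 1) * ?c \<le> m s * ?c" using I(2) by (intro mult_le_mono1) simp
    then have "bcost b + t + t' + 1 \<le> (m s + 1) * ?c" using t t' by simp
    then show ?thesis using exec.WhileTrue[OF True t(2) t'(1)] t' by blast
  qed
qed

section \<open>The program\<close>

abbreviation code :: "nat bcotree \<Rightarrow> nat list" where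
  "code t \<equiv> encode (cotree_of t)"

section \<open>Reading prefix codes\<close>

lemma length_code: "length (code t) + 1 = 2 * order t"
  by (induction t) auto

lemma code_nonempty: "code t \<noteq> []"
  by (cases t) auto

lemma drop_code_BLeaf:
  "drop i xs = code (BLeaf v) @ ys \<Longrightarrow> i < length xs \<and> xs ! i = v + 2 \<and> drop (Suc i) xs = ys"
  by (metis append_Cons append_Nil cotree_of.simps(1) drop_all encode.simps(1) leI list.distinct(1)
      list.sel(1,3) drop_Suc hd_drop_conv_nth tl_drop)

lemma drop_code_BNode:
  assumes "drop i xs = code (BNode l a b) @ ys"
  shows "i < length xs" and "xs ! i = label_code l" and "drop (Suc i) xs = code a @ code b @ ys"
    and "drop (i + 2 * order a) xs = code b @ ys"
proof -
  have *: "drop i xs = label_code l # code a @ code b @ ys" using assms by simp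
  then show i: "i < length xs" by (metis drop_all leI list.distinct(1))
  show "xs ! i = label_code l" using * i by (metis hd_drop_conv_nth list.sel(1))
  show **: "drop (Suc i) xs = code a @ code b @ ys" using * by (metis drop_Suc list.sel(3) tl_drop)
  \<comment> \<open>The root takes one cell and the left child \<open>2 * order a - 1\<close>
    cells.\<close>
  have "drop (i + 2 * order a) xs = drop (length (code a)) (drop (Suc i) xs)"
    unfolding length_code[of a, symmetric] by (simp add: add.commute)
  then show "drop (i + 2 * order a) xs = code b @ ys" using ** by simp
qed

text \<open>Unique readability: leaf codes are at least 2 and so differ from labels, and the left
  child is determined before the right one.\<close>

lemma code_append_inject: "code t @ ys = code u @ zs \<Longrightarrow> t = u"
proof (induction t arbitrary: u ys zs)
  case (BLeaf v)
  then show ?case by (cases u; cases "case u of BNode l a b \<Rightarrow> l") auto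
next
  case (BNode l a b)
  then obtain l' a' b' where u: "u = BNode l' a' b'"
    by (cases u; cases l) auto
  have "l = l'" using BNode.prems u by (cases l; cases l') auto
  have eq: "code a @ code b @ ys = code a' @ code b' @ zs" using BNode.prems u by simp
  then have "a = a'" by (rule BNode.IH(1))
  moreover from this have "b = b'" using eq BNode.IH(2) by simp
  ultimately show ?case using u \<open>l = l'\<close> by simp
qed

text \<open>Pass 1 visits every cell and must find the beginning of a subtree there.\<close>

lemma code_at_position: "i < length (code t) \<Longrightarrow> \<exists>u ys. drop i (code t) = code u @ ys"
proof (induction t arbitrary: i)
  case (BLeaf v)
  then have "drop i (code (BLeaf v)) = code (BLeaf v) @ []" by simp
  then show ?case by blast
next
  case (BNode l a b)
  consider "i = 0" | j where "i = Suc j" "j < length (code a)"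
    | j where "i = Suc j" "length (code a) \<le> j"
    by (metis leI not0_implies_Suc)
  then show ?case
  proof cases
    case 1
    then have "drop i (code (BNode l a b)) = code (BNode l a b) @ []" by simp
    then show ?thesis by blast
  next
    case 2
    then show ?thesis using BNode.IH(1)[of j] by force
  next
    case 3
    then show ?thesis using BNode.IH(2)[of "j - length (code a)"] BNode.prems by simp
  qed
qed

text \<open>For an input \<open>xs\<close>, the subtree rooted at position \<open>p\<close> is the unique \<open>t\<close> with
  \<open>drop p xs = code t @ ys\<close>.\<close>

definition tables :: "nat list \<Rightarrow> nat \<Rightarrow> (nat \<Rightarrow> nat) \<Rightarrow> (nat \<Rightarrow> nat) \<Rightarrow> bool" where
  "tables xs i sz ch \<longleftrightarrow>
     (\<forall>p t ys. i \<le> p \<and> drop p xs = code t @ ys \<longrightarrow> sz p = order t \<and> ch p = chi t)"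

text \<open>Array \<open>2\<close> receives the orders and array \<open>3\<close> the values of \<open>chi\<close>, from right to left. The left
  child of position \<open>i\<close> is at \<open>i + 1\<close>, the right one at \<open>i + 2 * order\<close> of the left one.\<close>

definition pass1 :: com where
  "pass1 =
     Seq (Assign 0 (Sub (Reg 0) (Const 1)))
     (If (Less (Get 0 (Reg 0)) (Const 2))
       (Seq (Assign 1 (Add (Reg 0) (Const 1)))
       (Seq (Assign 2 (Add (Reg 0) (Add (Get 2 (Reg 1)) (Get 2 (Reg 1)))))
       (Seq (Put 2 (Reg 0) (Add (Get 2 (Reg 1)) (Get 2 (Reg 2))))
       (If (Equal (Get 0 (Reg 0)) (Const 0))
         (If (Less (Get 3 (Reg 1)) (Get 3 (Reg 2)))
           (Put 3 (Reg 0) (Get 3 (Reg 2)))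
           (Put 3 (Reg 0) (Get 3 (Reg 1))))
         (Seq (Assign 3 (Add (Get 3 (Reg 1)) (Get 2 (Reg 2))))
         (Seq (Assign 4 (Add (Get 3 (Reg 2)) (Get 2 (Reg 1))))
         (If (Less (Reg 3) (Reg 4)) (Put 3 (Reg 0) (Reg 3)) (Put 3 (Reg 0) (Reg 4)))))))))
       (Seq (Put 2 (Reg 0) (Const 1)) (Put 3 (Reg 0) (Const 1))))"

text \<open>Arrays \<open>4\<close> and \<open>5\<close> form a stack of height register \<open>5\<close> with the arguments \<open>k\<close> and \<open>r\<close> of
  \<open>color\<close> for the subtrees whose codes make up the unread input.\<close>

definition pass2 :: com where
  "pass2 =
     Seq (Assign 5 (Sub (Reg 5) (Const 1)))
     (Seq (Assign 6 (Get 4 (Reg 5)))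
     (Seq (Assign 7 (Get 5 (Reg 5)))
     (Seq
     (If (Less (Get 0 (Reg 0)) (Const 2))
       (Seq (Assign 1 (Add (Reg 0) (Const 1)))
       (Seq (Assign 2 (Add (Reg 0) (Add (Get 2 (Reg 1)) (Get 2 (Reg 1)))))
       (Seq (Assign 3 (Reg 6))
       (Seq (Assign 4 (Reg 6))
       (Seq (Assign 8 (Reg 7))
       (Seq (Assign 9 (Reg 7))
       (Seq
       (If (Equal (Reg 7) (Const 1))
         (Assign 4 (Add (Reg 6) (Get 2 (Reg 1))))
         (If (Equal (Get 0 (Reg 0)) (Const 0))
           Skip
           (If (Less (Add (Get 3 (Reg 1)) (Get 2 (Reg 2))) (Add (Get 3 (Reg 2)) (Get 2 (Reg 1))))
             (Seq (Assign 4 (Add (Reg 6) (Get 3 (Reg 1)))) (Assign 9 (Const 1)))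
             (Seq (Assign 3 (Add (Reg 6) (Get 3 (Reg 2)))) (Assign 8 (Const 1))))))
       (Seq (Put 4 (Reg 5) (Reg 4))
       (Seq (Put 5 (Reg 5) (Reg 9))
       (Seq (Assign 5 (Add (Reg 5) (Const 1)))
       (Seq (Put 4 (Reg 5) (Reg 3))
       (Seq (Put 5 (Reg 5) (Reg 8))
       (Assign 5 (Add (Reg 5) (Const 1)))))))))))))))
       (Put 1 (Sub (Get 0 (Reg 0)) (Const 2)) (Reg 6)))
     (Assign 0 (Add (Reg 0) (Const 1))))))"

text \<open>The first loop leaves register 0 at 0, the reading position for the second. Setting
  register 5 to 1 makes the zero-initialized bottom of the stack the entry \<open>k = 0\<close>,
  \<open>r = False\<close> for the whole tree.\<close>

definition coloring_program :: com where
  "coloring_program =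
     Seq (While (Less (Const 0) (Reg 0)) pass1)
     (Seq (Assign 5 (Const 1))
     (While (Less (Const 0) (Reg 5)) pass2))"

lemma loop_free_passes: "loop_free pass1" "loop_free pass2"
  by (simp_all add: pass1_def pass2_def)

section \<open>The effect of one round of each pass\<close>

lemma set_reg_simps [simp]:
  "regs (set_reg r x s) = (regs s)(r := x)" "arrs (set_reg r x s) = arrs s"
  by (simp_all add: set_reg_def)

lemma set_arr_simps [simp]:
  "arrs (set_arr a i x s) = (arrs s)(a := (arrs s a)(i := x))" "regs (set_arr a i x s) = regs s"
  by (simp_all add: set_arr_def)

lemma run_pass1_BLeaf:
  assumes "regs s 0 = Suc i" "2 \<le> arrs s 0 i" "2 < (2::nat) ^ w" "0 < w"
  shows "regs (run w pass1 s) 0 = i"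
    and "arrs (run w pass1 s) = (arrs s)(2 := (arrs s 2)(i := 1), 3 := (arrs s 3)(i := 1))"
  using assms by (simp_all add: pass1_def)

text \<open>The bounds keep all sums below \<open>2 ^ w\<close>, so that addition is exact.\<close>

lemma run_pass1_BNode:
  assumes "regs s 0 = Suc i" "arrs s 0 i = label_code l" "2 < (2::nat) ^ w" "0 < w"
    and "arrs s 2 (Suc i) = oa" "arrs s 3 (Suc i) = ca" "0 < oa"
    and "arrs s 2 (i + 2 * oa) = ob" "arrs s 3 (i + 2 * oa) = cb"
    and "i + 2 * oa < 2 ^ w" "oa + ob < 2 ^ w" "ca + ob < 2 ^ w" "cb + oa < 2 ^ w"
  shows "regs (run w pass1 s) 0 = i"
    and "arrs (run w pass1 s) = (arrs s)(2 := (arrs s 2)(i := oa + ob),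
      3 := (arrs s 3)(i := if l = Cup then max ca cb else min (ca + ob) (cb + oa)))"
  \<comment> \<open>The program doubles by adding; flipping \<open>mult_2\<close> folds such sums
    into the \<open>2 * oa\<close> of the assumptions.\<close>
  using assms by (cases l; simp add: pass1_def fun_eq_iff max_def min_def flip: mult_2)+

text \<open>The arguments that \<open>color\<close> hands to the two children, isolated because pass
  2 pushes them as stack entries.\<close>

definition children ::
    "label \<Rightarrow> 'a bcotree \<Rightarrow> 'a bcotree \<Rightarrow> bool \<Rightarrow> nat \<Rightarrow> (bool \<times> nat) \<times> (bool \<times> nat)" where
  "children l a b r k =
    (if r then ((True, k), (True, k + order a))
     else if l = Cup then ((False, k), (False, k))
     else if chi a + order b < chi b + order a then ((False, k), (True, k + chi a))
     else ((True, k + chi b), (False, k)))"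

text \<open>The color intervals of the children end within that of the parent, which keeps all
  offsets at most \<open>n\<close> in pass 2.\<close>

lemma children_color:
  assumes "children l a b r k = ((ra, ka), (rb, kb))"
  shows "color (BNode l a b) r k v = (if v \<in> bverts a then color a ra ka v else color b rb kb v)"
    and "ka + ncolors ra a \<le> k + ncolors r (BNode l a b)"
    and "kb + ncolors rb b \<le> k + ncolors r (BNode l a b)"
  using assms by (cases l; auto simp: children_def ncolors_def split: if_splits)+

lemma run_pass2_BLeaf:
  assumes "regs s 5 = Suc h" "arrs s 0 (regs s 0) = v + 2" "2 < (2::nat) ^ w" "0 < w" "Suc (regs s 0) < 2 ^ w"
  shows "regs (run w pass2 s) 0 = Suc (regs s 0)" and "regs (run w pass2 s) 5 = h"
    and "arrs (run w pass2 s) = (arrs s)(1 := (arrs s 1)(v := arrs s 4 h))"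
  using assms by (simp_all add: pass2_def)

text \<open>The right child overwrites the popped entry and the left one goes on top, since prefix
  order reads the left child first.\<close>

lemma run_pass2_BNode:
  assumes "regs s 5 = Suc h" "regs s 0 = i" "arrs s 0 i = label_code l" "2 < (2::nat) ^ w" "0 < w"
    and "arrs s 2 (Suc i) = order a" "arrs s 3 (Suc i) = chi a"
    and "arrs s 2 (i + 2 * order a) = order b" "arrs s 3 (i + 2 * order a) = chi b"
    and "i + 2 * order a < 2 ^ w" "order a + order b < 2 ^ w" "k + order a < 2 ^ w" "k + order b < 2 ^ w"
    and "Suc i < 2 ^ w" "h + 2 < 2 ^ w"
    and "arrs s 4 h = k" "arrs s 5 h = of_bool r"
    and "children l a b r k = ((ra, ka), (rb, kb))"
  shows "regs (run w pass2 s) 0 = Suc i" and "regs (run w pass2 s) 5 = h + 2"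
    and "arrs (run w pass2 s) = (arrs s)(4 := (arrs s 4)(h := kb, Suc h := ka),
      5 := (arrs s 5)(h := of_bool rb, Suc h := of_bool ra))"
proof -
  have "chi a + order b < 2 ^ w" "chi b + order a < 2 ^ w" "k + chi a < 2 ^ w" "k + chi b < 2 ^ w"
    using assms(11-13) chi_le_order[of a] chi_le_order[of b] by linarith+
  note facts = assms this
  show "regs (run w pass2 s) 0 = Suc i" "regs (run w pass2 s) 5 = h + 2"
    using facts by (cases r; cases l; simp add: pass2_def flip: mult_2)+
  show "arrs (run w pass2 s) = (arrs s)(4 := (arrs s 4)(h := kb, Suc h := ka),
      5 := (arrs s 5)(h := of_bool rb, Suc h := of_bool ra))"
    using facts
    by (cases r; cases l; cases "chi a + order b < chi b + order a";
        simp add: pass2_def children_def fun_eq_iff flip: mult_2)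
qed

text \<open>The head of the list is the top; an entry's index is the number of entries below
  it.\<close>

primrec stack :: "(nat \<Rightarrow> nat) \<Rightarrow> (nat \<Rightarrow> nat) \<Rightarrow> ('a \<times> bool \<times> nat) list \<Rightarrow> bool" where
  "stack A B [] \<longleftrightarrow> True"
| "stack A B (e # q) \<longleftrightarrow>
     A (length q) = snd (snd e) \<and> B (length q) = of_bool (fst (snd e)) \<and> stack A B q"

lemma stack_upd [simp]:
  "length q \<le> h \<Longrightarrow> stack (A(h := x)) B q \<longleftrightarrow> stack A B q"
  "length q \<le> h \<Longrightarrow> stack A (B(h := x)) q \<longleftrightarrow> stack A B q"
  by (induction q) auto

text \<open>Each pending subtree owns at least one unread cell, which bounds the stack
  height.\<close>

lemma length_le_concat_code: "length q \<le> length (concat (map (code \<circ> fst) q))"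
proof (induction q)
  case (Cons e q)
  have "1 \<le> length (code (fst e))" using length_code[of "fst e"] order_pos[of "fst e"] by linarith
  with Cons show ?case by simp
qed simp

section \<open>Correctness of the two passes on a fixed input\<close>

context
  fixes t0 :: "nat bcotree" and w n :: nat and xs :: "nat list"
  assumes disj: "disjoint_leaves t0" and n: "n = order t0" and word: "8 * n \<le> 2 ^ w"
    and xs: "xs = code t0"
begin

lemma n_pos: "0 < n"
  using n by simp

lemma length_xs: "length xs + 1 = 2 * n"
  using length_code n xs by simp

text \<open>Positions stay below \<open>2 * n\<close>, orders at most \<open>n\<close>, color sums
  at most \<open>2 * n\<close> and stack heights below \<open>2 * n + 2\<close>. The bound
  \<open>8 * n\<close> exceeds all of these and the program constants.\<close>

lemma two_less_word: "2 < (2::nat) ^ w" and w_pos: "0 < w"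
proof -
  show "2 < (2::nat) ^ w" using word n_pos by linarith
  then show "0 < w" by (cases w) auto
qed

text \<open>The \<open>2 * order t - 1\<close> cells of the subtree end within the
  \<open>2 * n - 1\<close> cells of the input.\<close>

lemma position_bound:
  assumes "drop p xs = code t @ ys"
  shows "p + 2 * order t \<le> 2 * n"
proof -
  have "length xs - p = length (code t) + length ys"
    using arg_cong[OF assms, of length] by simp
  then show ?thesis
    using length_code[of t] order_pos[of t] length_xs by linarith
qed

text \<open>The zeros in arrays 4 and 5 are carried along as the first stack entry of pass
  2.\<close>

definition inv1 :: "state \<Rightarrow> bool" where
  "inv1 s \<longleftrightarrow> regs s 0 \<le> length xs \<and> (\<forall>i<length xs. arrs s 0 i = xs ! i) \<and>
     arrs s 4 0 = 0 \<and> arrs s 5 0 = 0 \<and> tables xs (regs s 0) (arrs s 2) (arrs s 3)"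

lemma tables_step:
  assumes "tables xs (Suc i) sz ch"
    and "\<And>t ys. drop i xs = code t @ ys \<Longrightarrow> x = order t \<and> y = chi t"
  shows "tables xs i (sz(i := x)) (ch(i := y))"
  using assms unfolding tables_def by (metis fun_upd_apply le_SucE le_antisym not_less_eq_eq)

lemma inv1_step:
  assumes "inv1 s" "0 < regs s 0"
  shows "inv1 (run w pass1 s) \<and> regs (run w pass1 s) 0 < regs s 0"
proof -
  obtain i where i: "regs s 0 = Suc i" using assms(2) gr0_implies_Suc by blast
  have tab: "tables xs (Suc i) (arrs s 2) (arrs s 3)" and "i < length xs" and xs_i: "arrs s 0 i = xs ! i"
    using assms(1) i by (auto simp: inv1_def)
  then obtain t ys where t: "drop i xs = code t @ ys" using code_at_position xs by blast
  let ?s = "run w pass1 s"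
  have *: "regs ?s 0 = i \<and> arrs ?s = (arrs s)(2 := (arrs s 2)(i := order t), 3 := (arrs s 3)(i := chi t))"
  proof (cases t)
    case (BLeaf v)
    then have "xs ! i = v + 2" using t drop_code_BLeaf by blast
    then show ?thesis
      using run_pass1_BLeaf[OF i _ two_less_word w_pos] xs_i BLeaf by simp
  next
    case (BNode l a b)
    note d = drop_code_BNode[OF t[unfolded BNode]]
    have a: "arrs s 2 (Suc i) = order a" "arrs s 3 (Suc i) = chi a"
      using tab d(3) unfolding tables_def by blast+
    \<comment> \<open>The right child lies beyond \<open>i\<close>, so its entries are already
      tabulated.\<close>
    have "Suc i \<le> i + 2 * order a" using order_pos[of a] by linarith
    then have b: "arrs s 2 (i + 2 * order a) = order b" "arrs s 3 (i + 2 * order a) = chi b"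
      using tab d(4) unfolding tables_def by blast+
    have bounds: "i + 2 * order a < 2 ^ w" "order a + order b < 2 ^ w" "chi a + order b < 2 ^ w"
      "chi b + order a < 2 ^ w"
      using position_bound[OF t] word n_pos chi_le_order[of a] chi_le_order[of b]
      unfolding BNode by simp_all
    show ?thesis
      using run_pass1_BNode[OF i _ two_less_word w_pos a order_pos b bounds, of l] xs_i d(2) BNode by simp
  qed
  \<comment> \<open>\<open>tables\<close> speaks of every tree readable at \<open>i\<close>; unique
    readability leaves only \<open>t\<close>.\<close>
  moreover have "tables xs i ((arrs s 2)(i := order t)) ((arrs s 3)(i := chi t))"
    using tables_step[OF tab] t code_append_inject by metis
  ultimately show ?thesis
    using assms(1) i by (simp add: inv1_def)
qed

text \<open>The list \<open>q\<close> adds to each stack entry its tree, which the arrays do not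
  store. The bound by \<open>n\<close> prevents overflow; once \<open>q\<close> is empty, the last
  conjunct is the desired result.\<close>

definition inv2 :: "state \<Rightarrow> bool" where
  "inv2 s \<longleftrightarrow> (\<exists>q. regs s 5 = length q \<and> drop (regs s 0) xs = concat (map (code \<circ> fst) q) \<and>
     (\<forall>i<length xs. arrs s 0 i = xs ! i) \<and> tables xs 0 (arrs s 2) (arrs s 3) \<and>
     stack (arrs s 4) (arrs s 5) q \<and>
     (\<forall>(t, r, k)\<in>set q. disjoint_leaves t \<and> k + ncolors r t \<le> n \<and>
        (\<forall>v\<in>bverts t. color t r k v = color t0 False 0 v)) \<and>
     (\<forall>v\<in>bverts t0. arrs s 1 v = color t0 False 0 v \<or> (\<exists>e\<in>set q. v \<in> bverts (fst e))))"

lemma inv2_step: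
  assumes "inv2 s" "0 < regs s 5"
  shows "inv2 (run w pass2 s) \<and> length xs - regs (run w pass2 s) 0 < length xs - regs s 0"
proof -
  let ?s = "run w pass2 s" and ?f = "color t0 False 0"
  define i where "i = regs s 0"
  obtain q0 where q0: "regs s 5 = length q0" "drop i xs = concat (map (code \<circ> fst) q0)"
    "\<forall>i<length xs. arrs s 0 i = xs ! i" "tables xs 0 (arrs s 2) (arrs s 3)"
    "stack (arrs s 4) (arrs s 5) q0"
    "\<forall>(t, r, k)\<in>set q0. disjoint_leaves t \<and> k + ncolors r t \<le> n \<and> (\<forall>v\<in>bverts t. color t r k v = ?f v)"
    "\<forall>v\<in>bverts t0. arrs s 1 v = ?f v \<or> (\<exists>e\<in>set q0. v \<in> bverts (fst e))"
    using assms(1) unfolding inv2_def i_def by blast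
  obtain t r k q where q: "q0 = (t, r, k) # q"
    using q0(1) assms(2) by (cases q0) auto
  define rest where "rest = concat (map (code \<circ> fst) q)"
  have t: "drop i xs = code t @ rest" using q0(2) by (simp add: q rest_def)
  have h: "regs s 5 = Suc (length q)" using q0(1) by (simp add: q)
  have top: "arrs s 4 (length q) = k" "arrs s 5 (length q) = of_bool r" "stack (arrs s 4) (arrs s 5) q"
    using q0(5) by (auto simp: q)
  have q_ok: "\<forall>(t, r, k)\<in>set q. disjoint_leaves t \<and> k + ncolors r t \<le> n \<and>
      (\<forall>v\<in>bverts t. color t r k v = ?f v)"
    using q0(6) by (simp add: q)
  have t_ok: "disjoint_leaves t" "k + ncolors r t \<le> n" "\<forall>v\<in>bverts t. color t r k v = ?f v"
    using q0(6) by (auto simp: q)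
  have colored: "arrs s 1 v = ?f v \<or> v \<in> bverts t \<or> (\<exists>e\<in>set q. v \<in> bverts (fst e))" if "v \<in> bverts t0" for v
    using q0(7) that by (auto simp: q)
  note pos = position_bound[OF t]
  have "length (concat (map (code \<circ> fst) q0)) = length xs - i" using q0(2) by (metis length_drop)
  then have height: "length q < 2 * n"
    using length_le_concat_code[of q0] length_xs by (simp add: q)
  \<comment> \<open>A nonempty stack means unread input, so the truncated difference in the measure
    really drops.\<close>
  have i: "i < length xs"
    using pos order_pos[of t] length_xs by linarith
  have xs_i: "arrs s 0 i = xs ! i" using q0(3) i by blast
  have Suc_i: "Suc i < 2 ^ w" using i length_xs word by linarith
  have "inv2 ?s \<and> regs ?s 0 = Suc i"
  proof (cases t)
    case (BLeaf v)
    then have d: "xs ! i = v + 2" "drop (Suc i) xs = rest" using t drop_code_BLeaf by blast+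
    have run: "regs ?s 0 = Suc i" "regs ?s 5 = length q" "arrs ?s = (arrs s)(1 := (arrs s 1)(v := k))"
      using run_pass2_BLeaf[OF h _ two_less_word w_pos, of v] d(1) xs_i Suc_i top
      by (simp_all flip: i_def)
    have "k = ?f v" using t_ok(3) BLeaf by simp
    with colored have "\<forall>u\<in>bverts t0. arrs ?s 1 u = ?f u \<or> (\<exists>e\<in>set q. u \<in> bverts (fst e))"
      using BLeaf by (auto simp: run)
    then have "inv2 ?s"
      unfolding inv2_def using q0(3,4) top q_ok d by (intro exI[of _ q]) (simp add: run rest_def)
    with run show ?thesis by simp
  next
    case (BNode l a b)
    note d = drop_code_BNode[OF t[unfolded BNode]]
    obtain ra ka rb kb where ch: "children l a b r k = ((ra, ka), (rb, kb))" by (metis surj_pair)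
    note ab = children_color[OF ch]
    have a: "arrs s 2 (Suc i) = order a" "arrs s 3 (Suc i) = chi a"
      and b: "arrs s 2 (i + 2 * order a) = order b" "arrs s 3 (i + 2 * order a) = chi b"
      using q0(4) d(3,4) unfolding tables_def by blast+
    have bounds: "i + 2 * order a < 2 ^ w" "order a + order b < 2 ^ w" "k + order a < 2 ^ w"
      "k + order b < 2 ^ w" "length q + 2 < 2 ^ w"
      using pos word t_ok(2) height n_pos unfolding BNode by simp_all
    note run = run_pass2_BNode[OF h i_def[symmetric] trans[OF xs_i d(2)] two_less_word w_pos a b
        bounds(1-4) Suc_i bounds(5) top(1,2) ch]
    let ?q = "(a, ra, ka) # (b, rb, kb) # q"
    have "disjoint_leaves a" "disjoint_leaves b" "bverts a \<inter> bverts b = {}"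
      using t_ok(1) BNode by auto
    moreover have "ka + ncolors ra a \<le> n" "kb + ncolors rb b \<le> n"
      using ab(2,3) t_ok(2) BNode by auto
    moreover have "color a ra ka v = ?f v" if "v \<in> bverts a" for v
      using that t_ok(3) BNode ab(1)[of v] by auto
    moreover have "color b rb kb v = ?f v" if "v \<in> bverts b" for v
      using that t_ok(3) BNode ab(1)[of v] \<open>bverts a \<inter> bverts b = {}\<close> by auto
    ultimately have "\<forall>(t, r, k)\<in>set ?q. disjoint_leaves t \<and> k + ncolors r t \<le> n \<and>
        (\<forall>v\<in>bverts t. color t r k v = ?f v)"
      using q_ok by simp
    moreover have "\<forall>v\<in>bverts t0. arrs ?s 1 v = ?f v \<or> (\<exists>e\<in>set ?q. v \<in> bverts (fst e))"
      using colored BNode by (auto simp: run)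
    moreover have "stack (arrs ?s 4) (arrs ?s 5) ?q" using top by (simp add: run)
    moreover have "drop (regs ?s 0) xs = concat (map (code \<circ> fst) ?q)"
      using d(3) by (simp add: run rest_def)
    moreover have "regs ?s 5 = length ?q" by (simp add: run)
    moreover have "\<forall>i<length xs. arrs ?s 0 i = xs ! i" "tables xs 0 (arrs ?s 2) (arrs ?s 3)"
      using q0(3,4) by (simp_all add: run)
    ultimately have "inv2 ?s" unfolding inv2_def by blast
    with run show ?thesis by simp
  qed
  with i show ?thesis by (simp add: i_def)
qed

lemma coloring_program_correct:
  "\<exists>t s. exec w coloring_program (input_state xs) t s \<and>
     t \<le> 2 * n * (max_cost pass1 + max_cost pass2 + 20) \<and>
     (\<forall>v\<in>bverts t0. output_coloring s v = color t0 False 0 v)"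
proof -
  let ?b1 = "Less (Const 0) (Reg 0)" and ?b2 = "Less (Const 0) (Reg 5)"
  \<comment> \<open>No tree can be read past the end of the input, so this holds vacuously.\<close>
  have "tables xs (length xs) sz ch" for sz ch
    by (auto simp: tables_def code_nonempty)
  then have "inv1 (input_state xs)"
    by (simp add: inv1_def input_state_def)
  then obtain t1 s1 where s1: "exec w (While ?b1 pass1) (input_state xs) t1 s1"
    "t1 \<le> (regs (input_state xs) 0 + 1) * (bcost ?b1 + max_cost pass1 + 1)"
    "inv1 s1" "\<not> bval w ?b1 s1"
    using exec_While[OF loop_free_passes(1), of inv1 w ?b1 "\<lambda>s. regs s 0" "input_state xs"] inv1_step
    by auto
  let ?s2 = "set_reg 5 1 s1"
  have init: "exec w (Assign 5 (Const 1)) s1 2 ?s2"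
    using exec.Assign[of w 5 "Const 1" s1] two_less_word w_pos by (simp add: numeral_2_eq_2)
  have s2: "regs s1 0 = 0" using s1(4) by simp
  have "inv2 ?s2"
    unfolding inv2_def
    by (rule exI[of _ "[(t0, False, 0)]"])
      (use s1(3)[unfolded inv1_def] s2 disj chi_le_order[of t0] in \<open>simp add: xs n ncolors_def\<close>)
  then obtain t2 s3 where s3: "exec w (While ?b2 pass2) ?s2 t2 s3"
    "t2 \<le> (length xs - regs ?s2 0 + 1) * (bcost ?b2 + max_cost pass2 + 1)"
    "inv2 s3" "\<not> bval w ?b2 s3"
    using exec_While[OF loop_free_passes(2), of inv2 w ?b2 "\<lambda>s. length xs - regs s 0" ?s2] inv2_step
    by auto
  have "exec w coloring_program (input_state xs) (t1 + (2 + t2 + 1) + 1) s3"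
    unfolding coloring_program_def by (rule exec.Seq[OF s1(1) exec.Seq[OF init s3(1)]])
  moreover have "t1 + (2 + t2 + 1) + 1 \<le> 2 * n * (max_cost pass1 + max_cost pass2 + 20)"
  proof -
    \<comment> \<open>The factor \<open>2 * n\<close> is \<open>length xs + 1\<close>; the 4 is the
      guard's cost 3 plus 1 per round. The constant 20 also absorbs the 4 units spent outside the
      loops.\<close>
    have "t1 \<le> 2 * n * (max_cost pass1 + 4)" "t2 \<le> 2 * n * (max_cost pass2 + 4)"
      using s1(2) s3(2) s2 unfolding length_xs[symmetric]
      by (simp_all add: input_state_def algebra_simps)
    then show ?thesis using n_pos by (simp add: algebra_simps)
  qed
  moreover have "\<forall>v\<in>bverts t0. output_coloring s3 v = color t0 False 0 v"
    using s3(3,4) by (auto simp: inv2_def output_coloring_def)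
  ultimately show ?thesis by blast
qed

end

theorem theorem6:
  "\<exists>(P :: com) (K :: nat) (time :: nat \<Rightarrow> real).
     time \<in> O(\<lambda>n. real n) \<and>
     (\<forall>(G :: nat graph) (T :: nat cotree) (n :: nat) (w :: nat).
        cograph G \<and> is_cotree T G \<and> binary T \<and> n = card (verts G) \<and>
        K * n \<le> 2 ^ w \<and> (\<forall>x \<in> set (encode T). x < 2 ^ w) \<longrightarrow>
        (\<exists>t s. exec w P (input_state (encode T)) t s \<and> real t \<le> time n \<and>
           optimal_acyclic_coloring G (output_coloring s) \<and>
           optimal_star_coloring G (output_coloring s)))"
proof -
  define c where "c = 2 * (max_cost pass1 + max_cost pass2 + 20)"
  have "(\<lambda>n. real (c * n)) \<in> O(\<lambda>n. real n)"
    by (intro bigoI[of _ "real c"]) simp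
  \<comment> \<open>The witness for \<open>K\<close> is 8, the factor in the word bound of the
    correctness lemma.\<close>
  moreover have "\<exists>t s. exec w coloring_program (input_state (encode T)) t s \<and> real t \<le> real (c * n) \<and>
      optimal_acyclic_coloring G (output_coloring s) \<and> optimal_star_coloring G (output_coloring s)"
    if G: "cograph G" "is_cotree T G" "binary T" and n: "n = card (verts G)" "8 * n \<le> 2 ^ w"
    for G T n w
  proof -
    obtain t0 where T: "T = cotree_of t0" using binary_imp_cotree_of[OF G(3)] by blast
    have rep: "represents t0 G" using is_cotree_represents G T by blast
    then have d: "disjoint_leaves t0" and "n = order t0"
      using n(1) card_bverts by (auto simp: represents_def)
    from coloring_program_correct[OF this n(2) refl] obtain t s where
      "exec w coloring_program (input_state (encode T)) t s" "t \<le> c * n"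
      "\<forall>v\<in>bverts t0. output_coloring s v = color t0 False 0 v"
      unfolding T c_def by (auto simp: ac_simps)
    then show ?thesis using color_optimal[OF rep] by (metis of_nat_mono)
  qed
  ultimately show ?thesis by blast
qed

end
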